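(* Let $1\le m\le n$ and let $|\!|\!|\cdot|\!|\!|$ be a normalized unitarily invariant norm on $M_m(\mathbb C)$. If $|\!|\!|\cdot|\!|\!|$ is an extreme point of $\mathfrak N(M_m(\mathbb C))$, then the induced norm $|\!|\!|\cdot|\!|\!|_1$ on $M_n(\mathbb C)$ is also an extreme point of $\mathfrak N(M_n(\mathbb C))$.
   Context: A norm on $M_k(\mathbb C)$ is unitarily invariant if $|\!|\!|UTV|\!|\!|=|\!|\!|T|\!|\!|$ for all $T$ and all unitary $U,V$, and normalized if $|\!|\!|1|\!|\!|=1$. $\mathfrak N(M_k(\mathbb C))$ is the convex set of normalized unitarily invariant norms on $M_k(\mathbb C)$. For scalars, $x_1\oplus\cdots\oplus x_k$ denotes the diagonal matrix in $M_k(\mathbb C)$ with these diagonal entries. Given $1\le m\le n$ and $|\!|\!|\cdot|\!|\!|\in\mathfrak N(M_m(\mathbb C))$, the induced norm $|\!|\!|\cdot|\!|\!|_1$ is the unique normalized unitarily invariant norm on $M_n(\mathbb C)$ such that $|\!|\!|1\oplus s_2\oplus\cdots\oplus s_n|\!|\!|_1=|\!|\!|1\oplus s_2\oplus\cdots\oplus s_m|\!|\!|$ for all $0\le s_n\le\cdots\le s_2\le1$ (such a norm exists and is unique). *)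

theory Defs
  imports "Jordan_Normal_Form.Schur_Decomposition"
begin

text \<open>
  The algebra of complex \<open>k \<times> k\<close> matrices is \<open>carrier_mat k k\<close>, and a norm on it is a function
  \<open>complex mat \<Rightarrow> real\<close> of which only the values on \<open>carrier_mat k k\<close> matter. Accordingly every
  condition below, including equality of two norms, is relative to this carrier.
\<close>

definition unitary_mats :: "nat \<Rightarrow> complex mat set" where
  "unitary_mats k = {U \<in> carrier_mat k k. mat_adjoint U * U = 1\<^sub>m k \<and> U * mat_adjoint U = 1\<^sub>m k}"

definition is_mat_norm :: "nat \<Rightarrow> (complex mat \<Rightarrow> real) \<Rightarrow> bool" where
  "is_mat_norm k N \<longleftrightarrow>
     (\<forall>T \<in> carrier_mat k k. 0 \<le> N T \<and> (N T = 0 \<longleftrightarrow> T = 0\<^sub>m k k)) \<and>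
     (\<forall>c. \<forall>T \<in> carrier_mat k k. N (c \<cdot>\<^sub>m T) = cmod c * N T) \<and>
     (\<forall>S \<in> carrier_mat k k. \<forall>T \<in> carrier_mat k k. N (S + T) \<le> N S + N T)"

definition unitarily_invariant :: "nat \<Rightarrow> (complex mat \<Rightarrow> real) \<Rightarrow> bool" where
  "unitarily_invariant k N \<longleftrightarrow>
     (\<forall>T \<in> carrier_mat k k. \<forall>U \<in> unitary_mats k. \<forall>V \<in> unitary_mats k. N (U * T * V) = N T)"

definition normalized_ui_norms :: "nat \<Rightarrow> (complex mat \<Rightarrow> real) set" where
  "normalized_ui_norms k = {N. is_mat_norm k N \<and> unitarily_invariant k N \<and> N (1\<^sub>m k) = 1}"

definition norm_eq_on :: "nat \<Rightarrow> (complex mat \<Rightarrow> real) \<Rightarrow> (complex mat \<Rightarrow> real) \<Rightarrow> bool" where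
  "norm_eq_on k N N' \<longleftrightarrow> (\<forall>T \<in> carrier_mat k k. N T = N' T)"

text \<open>
  The usual notion of extreme point (no proper convex combination of two distinct points of the
  convex set); the library's \<open>extreme_point_of\<close> is not applicable, since functions into the reals
  are not an instance of \<open>real_vector\<close>.
\<close>

definition extreme_normalized_ui_norm :: "nat \<Rightarrow> (complex mat \<Rightarrow> real) \<Rightarrow> bool" where
  "extreme_normalized_ui_norm k N \<longleftrightarrow>
     N \<in> normalized_ui_norms k \<and>
     (\<forall>A \<in> normalized_ui_norms k. \<forall>B \<in> normalized_ui_norms k. \<forall>t::real.
        0 < t \<and> t < 1 \<and> norm_eq_on k N (\<lambda>T. (1 - t) * A T + t * B T) \<longrightarrow> norm_eq_on k A B)"

text \<open>
  \<open>is_induced_norm m N n N1\<close>: the norm \<open>N1\<close> on \<open>n \<times> n\<close> matrices is the one induced by the norm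
  \<open>N\<close> on \<open>m \<times> m\<close> matrices. Indices start at \<open>0\<close>, so \<open>s 0\<close> is the leading entry \<open>1\<close>. The
  condition determines \<open>N1\<close> uniquely on \<open>carrier_mat n n\<close>, by singular value decomposition and
  homogeneity.
\<close>

definition is_induced_norm ::
    "nat \<Rightarrow> (complex mat \<Rightarrow> real) \<Rightarrow> nat \<Rightarrow> (complex mat \<Rightarrow> real) \<Rightarrow> bool" where
  "is_induced_norm m N n N1 \<longleftrightarrow>
     N1 \<in> normalized_ui_norms n \<and>
     (\<forall>s :: nat \<Rightarrow> real.
        s 0 = 1 \<and> (\<forall>i<n. 0 \<le> s i) \<and> (\<forall>i. Suc i < n \<longrightarrow> s (Suc i) \<le> s i) \<longrightarrow>
        N1 (mat_diag n (\<lambda>i. complex_of_real (s i))) = N (mat_diag m (\<lambda>i. complex_of_real (s i))))"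

end

theory Submission
  imports Defs "Jordan_Normal_Form.Spectral_Radius"
begin

text \<open>
  Write \<open>n = m + r\<close> and suppose \<open>N1 = (1 - t) A + t B\<close> with \<open>0 < t < 1\<close> and \<open>A\<close>, \<open>B\<close> normalized
  unitarily invariant norms on \<open>n \<times> n\<close> matrices. On a diagonal matrix \<open>D\<close> with decreasing
  entries \<open>1, s\<^sub>2, \<dots>, s\<^sub>n\<close> the induced norm \<open>N1\<close> does not see the last \<open>r\<close> entries, so it does not
  change when they are replaced by \<open>0\<close>. Such a truncation cannot increase a unitarily invariant
  norm (\<open>norm_truncation_le\<close>): the truncated matrix is the average of \<open>D\<close> and \<open>J D\<close> for a diagonal
  unitary \<open>J\<close> of signs. So \<open>A\<close> and \<open>B\<close> can only decrease, while a combination of them with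
  positive weights stays constant; hence neither \<open>A\<close> nor \<open>B\<close> sees the last \<open>r\<close> entries of \<open>D\<close>.

  Consequently \<open>A\<close> and \<open>B\<close> are determined, up to unitary equivalence and scaling, by their
  restrictions \<open>T \<mapsto> A (T \<oplus> 0)\<close> and \<open>T \<mapsto> B (T \<oplus> 0)\<close> to the upper left corner of size \<open>m\<close>. These are
  unitarily invariant norms (\<open>corner_norm\<close>), and they are normalized because the identity of size
  \<open>n\<close> is one of the matrices \<open>D\<close>. Their combination with weights \<open>1 - t\<close> and \<open>t\<close> agrees with \<open>N\<close>
  on diagonal matrices, hence everywhere. Extremality of \<open>N\<close> makes the two restrictions equal, and
  then \<open>A = B\<close>.

  Both passages from diagonal matrices to all matrices (\<open>unitarily_invariant_eqI\<close>) rest on the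
  singular value decomposition with decreasing singular values (\<open>svd\<close>). It is obtained by splitting
  off one pair of singular vectors at a time and sorting the singular values at the end.
\<close>

section \<open>Unitary matrices\<close>

lemma square_mult_carrier [simp]:
  "A \<in> carrier_mat n n \<Longrightarrow> B \<in> carrier_mat n n \<Longrightarrow> A * B \<in> carrier_mat n n"
  by (rule mult_carrier_mat)

lemma mat_adjoint_dim [simp]:
  "dim_row (mat_adjoint A) = dim_col A" "dim_col (mat_adjoint A) = dim_row A"
  by (simp_all add: mat_adjoint_def)

lemma mat_adjoint_carrier [simp]:
  "A \<in> carrier_mat nr nc \<Longrightarrow> mat_adjoint A \<in> carrier_mat nc nr"
  by (metis carrier_matD carrier_matI mat_adjoint_dim)

lemma mat_adjoint_index [simp]:
  fixes A :: "complex mat"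
  shows "i < dim_col A \<Longrightarrow> j < dim_row A \<Longrightarrow> mat_adjoint A $$ (i,j) = cnj (A $$ (j,i))"
  by (simp add: mat_adjoint_def mat_of_rows_index)

lemma mat_adjoint_adjoint [simp]: "mat_adjoint (mat_adjoint (A :: complex mat)) = A"
  by (rule eq_matI) auto

lemma mat_adjoint_mult:
  fixes A B :: "complex mat"
  assumes "A \<in> carrier_mat n k" "B \<in> carrier_mat k m"
  shows "mat_adjoint (A * B) = mat_adjoint B * mat_adjoint A"
  using assms by (intro eq_matI) (auto simp: scalar_prod_def mult.commute)

lemma mat_adjoint_one [simp]: "mat_adjoint (1\<^sub>m n :: complex mat) = 1\<^sub>m n"
  by (rule eq_matI) auto

lemma unitary_matsD:
  assumes "U \<in> unitary_mats n"
  shows "U \<in> carrier_mat n n" "mat_adjoint U * U = 1\<^sub>m n" "U * mat_adjoint U = 1\<^sub>m n"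
  using assms by (auto simp: unitary_mats_def)

lemma unitary_matsI:
  assumes "U \<in> carrier_mat n n" "mat_adjoint U * U = 1\<^sub>m n"
  shows "U \<in> unitary_mats n"
  using assms mat_mult_left_right_inverse[of "mat_adjoint U" n U]
  by (auto simp: unitary_mats_def)

lemma unitary_one: "1\<^sub>m n \<in> unitary_mats n"
  by (rule unitary_matsI) auto

lemma unitary_adjoint: "U \<in> unitary_mats n \<Longrightarrow> mat_adjoint U \<in> unitary_mats n"
  by (auto simp: unitary_mats_def)

lemma unitary_mult:
  assumes U: "U \<in> unitary_mats n" and V: "V \<in> unitary_mats n"
  shows "U * V \<in> unitary_mats n"
proof (rule unitary_matsI)
  note [simp] = unitary_matsD[OF U] unitary_matsD[OF V]
  show "U * V \<in> carrier_mat n n" by (rule mult_carrier_mat[of _ n n]) simp_all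
  have "mat_adjoint (U * V) * (U * V) = mat_adjoint V * mat_adjoint U * (U * V)"
    by (subst mat_adjoint_mult[of U n n V n]) simp_all
  also have "\<dots> = mat_adjoint V * (mat_adjoint U * U * V)"
    using unitary_matsD(1)[OF U] unitary_matsD(1)[OF V]
    by (simp only: assoc_mult_mat[of _ n n _ n _ n] square_mult_carrier mat_adjoint_carrier)
  also have "\<dots> = 1\<^sub>m n"
    by (simp add: left_mult_one_mat[of V n n])
  finally show "mat_adjoint (U * V) * (U * V) = 1\<^sub>m n" .
qed

text \<open>The defining property of the adjoint for the inner product \<open>v \<bullet>c w\<close>, linear in \<open>v\<close>.\<close>

lemma adjoint_scalar_prod:
  fixes A :: "complex mat"
  assumes "A \<in> carrier_mat nr nc" "v \<in> carrier_vec nc" "w \<in> carrier_vec nr"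
  shows "(A *\<^sub>v v) \<bullet>c w = v \<bullet>c (mat_adjoint A *\<^sub>v w)"
proof -
  have "(A *\<^sub>v v) \<bullet>c w = (\<Sum>i<nr. \<Sum>j<nc. A $$ (i,j) * v $ j * cnj (w $ i))"
    using assms by (simp add: scalar_prod_def sum_distrib_right atLeast0LessThan)
  also have "\<dots> = (\<Sum>j<nc. \<Sum>i<nr. A $$ (i,j) * v $ j * cnj (w $ i))"
    by (rule sum.swap)
  also have "\<dots> = v \<bullet>c (mat_adjoint A *\<^sub>v w)"
    using assms by (simp add: scalar_prod_def sum_distrib_left atLeast0LessThan mult_ac)
  finally show ?thesis .
qed

lemma vec_norm_square:
  fixes v :: "complex vec"
  shows "v \<bullet>c v = complex_of_real (\<Sum>i<dim_vec v. (cmod (v $ i))\<^sup>2)"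
  by (simp add: scalar_prod_def atLeast0LessThan complex_norm_square[symmetric] flip: of_real_power)

lemma smult_vec_cancel:
  fixes v w :: "complex vec"
  assumes "c \<noteq> 0" "c \<cdot>\<^sub>v v = c \<cdot>\<^sub>v w"
  shows "v = w"
proof (rule eq_vecI)
  show d: "dim_vec v = dim_vec w" using assms(2) by (metis index_smult_vec(2))
  show "v $ i = w $ i" if "i < dim_vec w" for i
    using arg_cong[OF assms(2), of "\<lambda>x. x $ i"] that d assms(1) by simp
qed

lemma scalar_multiple_of_unit_vec:
  fixes v :: "complex vec"
  assumes v: "v \<in> carrier_vec n" and v0: "v \<noteq> 0\<^sub>v n"
  obtains c u where "c > 0" "u \<in> carrier_vec n" "u \<bullet>c u = 1" "v = complex_of_real c \<cdot>\<^sub>v u"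
    "v \<bullet>c v = complex_of_real (c\<^sup>2)"
proof -
  define s where "s = (\<Sum>i<dim_vec v. (cmod (v $ i))\<^sup>2)"
  have vs: "v \<bullet>c v = complex_of_real s" unfolding s_def by (rule vec_norm_square)
  have "v \<bullet>c v \<noteq> 0" using v v0 by simp
  then have "s \<noteq> 0" using vs by auto
  moreover have "s \<ge> 0" unfolding s_def by (simp add: sum_nonneg)
  ultimately have s: "s > 0" by simp
  define c where "c = sqrt s"
  have c: "c > 0" "c\<^sup>2 = s" using s by (auto simp: c_def)
  define u where "u = complex_of_real (1 / c) \<cdot>\<^sub>v v"
  have u: "u \<in> carrier_vec n" using v by (simp add: u_def)
  have "u \<bullet>c u = complex_of_real (1 / c) * (complex_of_real (1 / c) * (v \<bullet>c v))"
    using v by (simp add: u_def conjugate_smult_vec)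
  also have "\<dots> = complex_of_real (1 / c * (1 / c * s))" by (simp add: vs)
  also have "\<dots> = 1" using c by (simp add: c(2)[symmetric] power2_eq_square less_imp_neq[THEN not_sym])
  finally have "u \<bullet>c u = 1" .
  moreover have "v = complex_of_real c \<cdot>\<^sub>v u"
    using c v by (intro eq_vecI) (auto simp: u_def)
  ultimately show thesis using that[of c u] c u vs by simp
qed

text \<open>
  Complete \<open>v\<close> to a basis, apply Gram-Schmidt, which leaves the first vector alone, and divide every
  vector by its length.
\<close>

lemma unitary_with_first_column:
  fixes v :: "complex vec"
  assumes v: "v \<in> carrier_vec n" and v1: "v \<bullet>c v = 1"
  obtains U where "U \<in> unitary_mats n" "col U 0 = v"
proof -
  have v0: "v \<noteq> 0\<^sub>v n" using v1 v by auto
  have n: "n > 0"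
  proof (rule ccontr)
    assume "\<not> n > 0"
    then have "v = 0\<^sub>v n" using v by (intro eq_vecI) auto
    with v0 show False ..
  qed
  interpret cof_vec_space n "TYPE(complex)" .
  define ws where "ws = gram_schmidt n (basis_completion v)"
  note b = basis_completion[OF v v0]
  have ws: "set ws \<subseteq> carrier_vec n" "corthogonal ws" "length ws = n"
    using gram_schmidt_result[OF b(2,4,5) ws_def] b(6) by simp_all
  have hd: "hd ws = v"
    using gram_schmidt_hd[OF v] b(6,7) n unfolding ws_def
    by (metis length_greater_0_conv list.collapse)
  have ws0: "ws ! 0 = v" using hd ws(3) n by (metis hd_conv_nth length_greater_0_conv)
  have wsc: "ws ! i \<in> carrier_vec n" if "i < n" for i using ws that by auto
  have wsne: "ws ! i \<noteq> 0\<^sub>v n" if "i < n" for i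
  proof
    assume z: "ws ! i = 0\<^sub>v n"
    have "ws ! i \<bullet>c ws ! i \<noteq> 0" using corthogonalD[OF ws(2), of i i] that ws(3) by simp
    with z show False by simp
  qed
  have "\<forall>i. \<exists>c u. i < n \<longrightarrow> c > (0::real) \<and> u \<in> carrier_vec n \<and> u \<bullet>c u = 1
      \<and> ws ! i = complex_of_real c \<cdot>\<^sub>v u \<and> ws ! i \<bullet>c ws ! i = complex_of_real (c\<^sup>2)"
    by (metis scalar_multiple_of_unit_vec wsc wsne)
  then obtain c u where cu: "\<And>i. i < n \<Longrightarrow> c i > (0::real)"
      "\<And>i. i < n \<Longrightarrow> u i \<in> carrier_vec n" "\<And>i. i < n \<Longrightarrow> u i \<bullet>c u i = 1"
      "\<And>i. i < n \<Longrightarrow> ws ! i = complex_of_real (c i) \<cdot>\<^sub>v u i"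
      "\<And>i. i < n \<Longrightarrow> ws ! i \<bullet>c ws ! i = complex_of_real ((c i)\<^sup>2)"
    by metis
  have orth: "u i \<bullet>c u j = 0" if ij: "i < n" "j < n" "i \<noteq> j" for i j
  proof -
    have "ws ! i \<bullet>c ws ! j = 0" using corthogonalD[OF ws(2), of i j] ij ws(3) by simp
    moreover have "ws ! i \<bullet>c ws ! j
        = complex_of_real (c i) * (complex_of_real (c j) * (u i \<bullet>c u j))"
      using cu(2)[OF ij(1)] cu(2)[OF ij(2)]
      by (simp add: cu(4)[OF ij(1)] cu(4)[OF ij(2)] conjugate_smult_vec)
    ultimately show ?thesis using cu(1)[OF ij(1)] cu(1)[OF ij(2)] by auto
  qed
  \<comment> \<open>Normalizing does not move the first vector, since \<open>v\<close> already has length \<open>1\<close>.\<close>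
  have "(c 0)\<^sup>2 = 1"
    using cu(5)[OF n] v1 ws0 by (metis of_real_eq_1_iff)
  then have "c 0 = 1" using cu(1)[OF n] by (simp add: power2_eq_1_iff)
  then have u0: "u 0 = v" using cu(2,4)[OF n] ws0 by simp
  define U where "U = mat n n (\<lambda>(i,j). u j $ i)"
  have U: "U \<in> carrier_mat n n" by (simp add: U_def)
  have "mat_adjoint U * U = 1\<^sub>m n"
  proof (rule eq_matI)
    fix i j assume ij: "i < dim_row (1\<^sub>m n :: complex mat)" "j < dim_col (1\<^sub>m n :: complex mat)"
    have "(mat_adjoint U * U) $$ (i,j) = u j \<bullet>c u i"
      using ij cu(2)[of i] cu(2)[of j] by (simp add: U_def scalar_prod_def mult.commute)
    then show "(mat_adjoint U * U) $$ (i,j) = 1\<^sub>m n $$ (i,j)"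
      using ij cu(3)[of i] orth[of j i] by auto
  qed (simp_all add: U_def)
  then have "U \<in> unitary_mats n" by (rule unitary_matsI[OF U])
  moreover have "col U 0 = v"
    using n v u0 by (intro eq_vecI) (auto simp: U_def)
  ultimately show thesis by (rule that)
qed

section \<open>Block diagonal matrices\<close>

definition mat_direct_sum :: "'a::zero mat \<Rightarrow> 'a mat \<Rightarrow> 'a mat" (infixr "\<oplus>\<^sub>m" 65) where
  "A \<oplus>\<^sub>m B = four_block_mat A (0\<^sub>m (dim_row A) (dim_col B)) (0\<^sub>m (dim_row B) (dim_col A)) B"

lemma direct_sum_carrier [simp]:
  "A \<in> carrier_mat a b \<Longrightarrow> B \<in> carrier_mat c d \<Longrightarrow> A \<oplus>\<^sub>m B \<in> carrier_mat (a + c) (b + d)"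
  by (simp add: mat_direct_sum_def)

lemma direct_sum_mult:
  fixes A B C D :: "complex mat"
  assumes "A \<in> carrier_mat a a" "B \<in> carrier_mat b b" "C \<in> carrier_mat a a" "D \<in> carrier_mat b b"
  shows "(A \<oplus>\<^sub>m B) * (C \<oplus>\<^sub>m D) = (A * C) \<oplus>\<^sub>m (B * D)"
  using assms unfolding mat_direct_sum_def
  by (subst mult_four_block_mat[of _ a a _ b _ b _ _ a _ b])
    (auto intro!: cong_four_block_mat left_add_zero_mat right_add_zero_mat)

lemma direct_sum_add:
  fixes A B C D :: "complex mat"
  assumes "A \<in> carrier_mat a a" "B \<in> carrier_mat b b" "C \<in> carrier_mat a a" "D \<in> carrier_mat b b"
  shows "(A \<oplus>\<^sub>m B) + (C \<oplus>\<^sub>m D) = (A + C) \<oplus>\<^sub>m (B + D)"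
  using assms by (intro eq_matI) (auto simp: mat_direct_sum_def)

lemma direct_sum_smult:
  fixes A B :: "complex mat"
  assumes "A \<in> carrier_mat a a" "B \<in> carrier_mat b b"
  shows "c \<cdot>\<^sub>m (A \<oplus>\<^sub>m B) = (c \<cdot>\<^sub>m A) \<oplus>\<^sub>m (c \<cdot>\<^sub>m B)"
  using assms by (intro eq_matI) (auto simp: mat_direct_sum_def)

lemma direct_sum_adjoint:
  fixes A B :: "complex mat"
  assumes "A \<in> carrier_mat a a" "B \<in> carrier_mat b b"
  shows "mat_adjoint (A \<oplus>\<^sub>m B) = mat_adjoint A \<oplus>\<^sub>m mat_adjoint B"
  using assms by (intro eq_matI) (auto simp: mat_direct_sum_def)

lemma direct_sum_one: "1\<^sub>m a \<oplus>\<^sub>m 1\<^sub>m b = 1\<^sub>m (a + b)"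
  by (simp add: mat_direct_sum_def)

lemma mat_diag_direct_sum:
  "mat_diag (a + b) f = mat_diag a f \<oplus>\<^sub>m mat_diag b (\<lambda>i. f (a + i))"
  by (intro eq_matI) (auto simp: mat_direct_sum_def mat_diag_def)

lemma unitary_direct_sum:
  assumes U: "U \<in> unitary_mats a" and V: "V \<in> unitary_mats b"
  shows "U \<oplus>\<^sub>m V \<in> unitary_mats (a + b)"
proof (rule unitary_matsI)
  note c = unitary_matsD(1)[OF U] unitary_matsD(1)[OF V]
  show "U \<oplus>\<^sub>m V \<in> carrier_mat (a + b) (a + b)" using c by simp
  show "mat_adjoint (U \<oplus>\<^sub>m V) * (U \<oplus>\<^sub>m V) = 1\<^sub>m (a + b)"
    using c unitary_matsD(2)[OF U] unitary_matsD(2)[OF V]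
    by (simp add: direct_sum_adjoint[of U a V b] direct_sum_mult[of _ a _ b] direct_sum_one)
qed

section \<open>Singular value decomposition\<close>

text \<open>
  An eigenvector \<open>v\<close> of \<open>T\<^sup>* T\<close> is a right singular vector. If \<open>T v \<noteq> 0\<close>, its direction \<open>u\<close> is the
  matching left singular vector. If \<open>T v = 0\<close>, then \<open>T\<close> is singular, hence so is \<open>T T\<^sup>*\<close>, and any
  unit vector \<open>u\<close> in the kernel of \<open>T T\<^sup>*\<close>, which is the kernel of \<open>T\<^sup>*\<close>, will do.
\<close>

lemma exists_singular_vectors:
  fixes T :: "complex mat"
  assumes T: "T \<in> carrier_mat n n" and n: "n > 0"
  obtains \<sigma> u v where "\<sigma> \<ge> 0" "u \<in> carrier_vec n" "u \<bullet>c u = 1" "v \<in> carrier_vec n" "v \<bullet>c v = 1"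
    "T *\<^sub>v v = complex_of_real \<sigma> \<cdot>\<^sub>v u" "mat_adjoint T *\<^sub>v u = complex_of_real \<sigma> \<cdot>\<^sub>v v"
proof -
  let ?T' = "mat_adjoint T"
  have T': "?T' \<in> carrier_mat n n" using T by simp
  have TT: "?T' * T \<in> carrier_mat n n" using T T' by simp
  obtain k where "eigenvalue (?T' * T) k"
    using spectrum_non_empty[OF TT n] by (auto simp: spectrum_def)
  then obtain w where w: "w \<in> carrier_vec n" "w \<noteq> 0\<^sub>v n" "(?T' * T) *\<^sub>v w = k \<cdot>\<^sub>v w"
    using TT T by (auto simp: eigenvalue_def eigenvector_def)
  obtain c v where v: "c > 0" "v \<in> carrier_vec n" "v \<bullet>c v = 1" "w = complex_of_real c \<cdot>\<^sub>v v"
    using scalar_multiple_of_unit_vec[OF w(1,2)] by blast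
  have Tv: "T *\<^sub>v v \<in> carrier_vec n" using T v by simp
  have "complex_of_real c \<cdot>\<^sub>v ((?T' * T) *\<^sub>v v) = complex_of_real c \<cdot>\<^sub>v (k \<cdot>\<^sub>v v)"
    using w(3) TT v by (simp add: mult_mat_vec smult_smult_assoc mult.commute)
  then have "(?T' * T) *\<^sub>v v = k \<cdot>\<^sub>v v"
    by (rule smult_vec_cancel[rotated]) (use v(1) in simp)
  then have ev: "?T' *\<^sub>v (T *\<^sub>v v) = k \<cdot>\<^sub>v v"
    using v(2) T T' by (simp add: assoc_mult_mat_vec[of _ n n _ n])
  show thesis
  proof (cases "T *\<^sub>v v = 0\<^sub>v n")
    case False
    obtain \<sigma> u where u: "\<sigma> > 0" "u \<in> carrier_vec n" "u \<bullet>c u = 1"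
        "T *\<^sub>v v = complex_of_real \<sigma> \<cdot>\<^sub>v u" "(T *\<^sub>v v) \<bullet>c (T *\<^sub>v v) = complex_of_real (\<sigma>\<^sup>2)"
      using scalar_multiple_of_unit_vec[OF Tv False] by blast
    have "complex_of_real (\<sigma>\<^sup>2) = v \<bullet>c (k \<cdot>\<^sub>v v)"
      using adjoint_scalar_prod[OF T v(2) Tv] u(5) ev by simp
    also have "\<dots> = cnj k" using v(2,3) by (simp add: conjugate_smult_vec)
    finally have k: "k = complex_of_real (\<sigma>\<^sup>2)" by (metis complex_cnj_cnj complex_cnj_complex_of_real)
    have "complex_of_real \<sigma> \<cdot>\<^sub>v (?T' *\<^sub>v u) = complex_of_real \<sigma> \<cdot>\<^sub>v (complex_of_real \<sigma> \<cdot>\<^sub>v v)"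
      using ev u(2,4) T' by (simp add: k mult_mat_vec smult_smult_assoc power2_eq_square)
    then have "?T' *\<^sub>v u = complex_of_real \<sigma> \<cdot>\<^sub>v v"
      by (rule smult_vec_cancel[rotated]) (use u(1) in simp)
    with u v that[of \<sigma> u v] show thesis by simp
  next
    case True
    have "det T = 0"
      using det_0_iff_vec_prod_zero[OF T] v True by (metis conjugate_square_eq_0_vec zero_neq_one)
    then have "det (T * ?T') = 0" using det_mult[OF T T'] by simp
    then obtain y where y: "y \<in> carrier_vec n" "y \<noteq> 0\<^sub>v n" "(T * ?T') *\<^sub>v y = 0\<^sub>v n"
      using det_0_iff_vec_prod_zero[of "T * ?T'" n] square_mult_carrier[OF T T'] by blast
    have T'y: "?T' *\<^sub>v y \<in> carrier_vec n" using T' y by simp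
    have "T *\<^sub>v (?T' *\<^sub>v y) = 0\<^sub>v n" using y T T' by (simp add: assoc_mult_mat_vec[of _ n n _ n])
    then have "(?T' *\<^sub>v y) \<bullet>c (?T' *\<^sub>v y) = 0"
      using adjoint_scalar_prod[OF T T'y y(1)] y by simp
    then have z: "?T' *\<^sub>v y = 0\<^sub>v n" using T'y by simp
    obtain d u where u: "d > 0" "u \<in> carrier_vec n" "u \<bullet>c u = 1" "y = complex_of_real d \<cdot>\<^sub>v u"
      using scalar_multiple_of_unit_vec[OF y(1,2)] by blast
    have "complex_of_real d \<cdot>\<^sub>v (?T' *\<^sub>v u) = 0\<^sub>v n"
      using z u T' by (simp add: mult_mat_vec)
    also have "\<dots> = complex_of_real d \<cdot>\<^sub>v 0\<^sub>v n" by (rule eq_vecI) simp_all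
    finally have "?T' *\<^sub>v u = 0\<^sub>v n"
      by (rule smult_vec_cancel[rotated]) (use u(1) in simp)
    moreover have "0 \<cdot>\<^sub>v x = 0\<^sub>v n" if "x \<in> carrier_vec n" for x :: "complex vec"
      using that by (intro eq_vecI) simp_all
    ultimately show thesis using u v True by (intro that[of 0 u v]) simp_all
  qed
qed

text \<open>
  Induction on the size. With singular vectors \<open>u\<close>, \<open>v\<close> for \<open>\<sigma>\<close> as first columns of unitary matrices
  \<open>U\<close>, \<open>V\<close>, the equation \<open>T v = \<sigma> u\<close> clears the first column of \<open>U\<^sup>* T V\<close> below the corner, and
  \<open>T\<^sup>* u = \<sigma> v\<close> clears its first row, so that \<open>U\<^sup>* T V = \<sigma> \<oplus> R\<close> with \<open>R\<close> smaller by one.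
\<close>

lemma svd_unsorted:
  fixes T :: "complex mat"
  assumes "T \<in> carrier_mat n n"
  shows "\<exists>U\<in>unitary_mats n. \<exists>V\<in>unitary_mats n. \<exists>d. (\<forall>i<n. 0 \<le> d i) \<and>
    T = U * mat_diag n (\<lambda>i. complex_of_real (d i)) * V"
  using assms
proof (induction n arbitrary: T)
  case 0
  then show ?case
    by (intro bexI[of _ "1\<^sub>m 0"] exI[of _ "\<lambda>_. 0"] unitary_one conjI) (auto simp: mat_diag_def)
next
  case (Suc k)
  let ?n = "Suc k"
  note T = Suc.prems
  obtain \<sigma> u v where uv: "\<sigma> \<ge> 0" "u \<in> carrier_vec ?n" "u \<bullet>c u = 1" "v \<in> carrier_vec ?n" "v \<bullet>c v = 1"
    "T *\<^sub>v v = complex_of_real \<sigma> \<cdot>\<^sub>v u" "mat_adjoint T *\<^sub>v u = complex_of_real \<sigma> \<cdot>\<^sub>v v"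
    using exists_singular_vectors[OF T] by blast
  obtain U where U: "U \<in> unitary_mats ?n" "col U 0 = u"
    using unitary_with_first_column[OF uv(2,3)] .
  obtain V where V: "V \<in> unitary_mats ?n" "col V 0 = v"
    using unitary_with_first_column[OF uv(4,5)] .
  have colsp: "v' \<bullet>c v = (\<Sum>i<?n. v' $ i * cnj (v $ i))" if "v \<in> carrier_vec ?n" for v v' :: "complex vec"
    using that by (simp add: scalar_prod_def atLeast0LessThan)
  have orth: "col W 0 \<bullet>c col W i = (if i = 0 then 1 else 0)" if "W \<in> unitary_mats ?n" "i < ?n" for W i
  proof -
    have "(mat_adjoint W * W) $$ (i, 0) = col W 0 \<bullet>c col W i"
      using that unitary_matsD(1)[OF that(1)] by (simp add: scalar_prod_def mult.commute)
    then show ?thesis using unitary_matsD(2)[OF that(1)] that(2) by simp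
  qed
  have Uc: "U \<in> carrier_mat ?n ?n" and Vc: "V \<in> carrier_mat ?n ?n"
    using U V by (auto dest: unitary_matsD)
  define S where "S = mat_adjoint U * T * V"
  have S: "S \<in> carrier_mat ?n ?n" using Uc Vc T by (simp add: S_def)
  have Sij: "S $$ (i,j) = (T *\<^sub>v col V j) \<bullet>c col U i" if "i < ?n" "j < ?n" for i j
  proof -
    have "S = mat_adjoint U * (T * V)" using Uc Vc T by (simp add: S_def assoc_mult_mat[of _ ?n ?n _ ?n _ ?n])
    then have "S $$ (i,j) = (\<Sum>l<?n. cnj (U $$ (l,i)) * (row T l \<bullet> col V j))"
      using that Uc Vc T by (simp add: scalar_prod_def atLeast0LessThan del: sum.lessThan_Suc)
    also have "\<dots> = (T *\<^sub>v col V j) \<bullet>c col U i"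
      using that Uc Vc T by (simp add: scalar_prod_def atLeast0LessThan mult.commute del: sum.lessThan_Suc)
    finally show ?thesis .
  qed
  have S_col: "S $$ (i,0) = (if i = 0 then complex_of_real \<sigma> else 0)" if "i < ?n" for i
    using Sij[OF that, of 0] orth[OF U(1) that] U V uv Uc that by simp
  have S_row: "S $$ (0,j) = (if j = 0 then complex_of_real \<sigma> else 0)" if "j < ?n" for j
  proof -
    have "S $$ (0,j) = (T *\<^sub>v col V j) \<bullet>c u" using Sij[of 0 j] that U by simp
    also have "\<dots> = col V j \<bullet>c (complex_of_real \<sigma> \<cdot>\<^sub>v v)"
      using adjoint_scalar_prod[OF T _ uv(2)] Vc that uv(7) by simp
    also have "\<dots> = complex_of_real \<sigma> * cnj (col V 0 \<bullet>c col V j)"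
      using V Vc uv(4) that
      by (simp add: conjugate_smult_vec colsp mult.commute del: sum.lessThan_Suc)
    finally show ?thesis using orth[OF V(1) that] by simp
  qed
  define R where "R = mat k k (\<lambda>(i,j). S $$ (Suc i, Suc j))"
  have R: "R \<in> carrier_mat k k" by (simp add: R_def)
  have S_sum: "S = mat_diag 1 (\<lambda>_. complex_of_real \<sigma>) \<oplus>\<^sub>m R"
    using S S_row S_col by (intro eq_matI) (auto simp: mat_direct_sum_def R_def mat_diag_def)
  obtain U' V' d where IH: "U' \<in> unitary_mats k" "V' \<in> unitary_mats k" "\<forall>i<k. 0 \<le> d i"
      "R = U' * mat_diag k (\<lambda>i. complex_of_real (d i)) * V'"
    using Suc.IH[OF R] by blast
  define e where "e = (\<lambda>i. if i = 0 then \<sigma> else d (i - 1))"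
  have e: "\<forall>i<?n. 0 \<le> e i" using IH uv by (auto simp: e_def)
  note c' = unitary_matsD(1)[OF IH(1)] unitary_matsD(1)[OF IH(2)]
  let ?U = "1\<^sub>m 1 \<oplus>\<^sub>m U'" and ?V = "1\<^sub>m 1 \<oplus>\<^sub>m V'" and ?E = "mat_diag ?n (\<lambda>i. complex_of_real (e i))"
  have UV: "?U \<in> unitary_mats ?n" "?V \<in> unitary_mats ?n"
    using unitary_direct_sum[OF unitary_one IH(1), of 1] unitary_direct_sum[OF unitary_one IH(2), of 1]
    by simp_all
  have E: "?E = mat_diag 1 (\<lambda>_. complex_of_real \<sigma>) \<oplus>\<^sub>m mat_diag k (\<lambda>i. complex_of_real (d i))"
    by (intro eq_matI) (auto simp: mat_direct_sum_def mat_diag_def e_def)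
  have S_svd: "S = ?U * ?E * ?V"
    unfolding E S_sum using c' by (simp add: direct_sum_mult[of _ 1 _ k] IH(4)
        left_mult_one_mat[OF mat_diag_dim] right_mult_one_mat[OF mat_diag_dim] del: One_nat_def)
  note UVc = UV[THEN unitary_matsD(1)]
  have "T = U * S * mat_adjoint V"
  proof -
    have "U * S * mat_adjoint V = (U * mat_adjoint U) * T * (V * mat_adjoint V)"
      unfolding S_def using Uc Vc T
      by (simp only: assoc_mult_mat[of _ ?n ?n _ ?n _ ?n] square_mult_carrier mat_adjoint_carrier)
    then show ?thesis using unitary_matsD(3)[OF U(1)] unitary_matsD(3)[OF V(1)] T by simp
  qed
  also have "\<dots> = (U * ?U) * ?E * (?V * mat_adjoint V)"
    unfolding S_svd using Uc Vc UVc
    by (simp only: assoc_mult_mat[of _ ?n ?n _ ?n _ ?n] square_mult_carrier mat_adjoint_carrier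
        mat_diag_dim)
  finally show ?case
    using e unitary_mult[OF U(1) UV(1)] unitary_mult[OF UV(2) unitary_adjoint[OF V(1)]] by blast
qed

text \<open>The unitary matrix is the permutation matrix of \<open>p\<close>.\<close>

lemma mat_diag_permute:
  fixes d :: "nat \<Rightarrow> complex"
  assumes p: "p permutes {..<n}"
  obtains P where "P \<in> unitary_mats n" "mat_diag n d = P * mat_diag n (\<lambda>i. d (p i)) * mat_adjoint P"
proof
  define P :: "complex mat" where "P = mat n n (\<lambda>(i,j). if i = p j then 1 else 0)"
  have P: "P \<in> carrier_mat n n" by (simp add: P_def)
  have pn: "p i < n" if "i < n" for i using permutes_in_image[OF p, of i] that by simp
  have "mat_adjoint P * P = 1\<^sub>m n"
  proof (rule eq_matI)
    fix i j assume ij: "i < dim_row (1\<^sub>m n :: complex mat)" "j < dim_col (1\<^sub>m n :: complex mat)"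
    have "(mat_adjoint P * P) $$ (i,j) = (\<Sum>l<n. mat_adjoint P $$ (i,l) * P $$ (l,j))"
      using ij P by (simp add: scalar_prod_def atLeast0LessThan)
    also have "\<dots> = (\<Sum>l<n. if l = p j then if p j = p i then 1 else 0 else 0)"
      using ij by (intro sum.cong) (auto simp: P_def)
    also have "\<dots> = (if p j = p i then 1 else 0)" using pn[of j] ij by simp
    also have "\<dots> = 1\<^sub>m n $$ (i,j)" using ij permutes_inj[OF p] by (auto dest: injD)
    finally show "(mat_adjoint P * P) $$ (i,j) = 1\<^sub>m n $$ (i,j)" .
  qed (simp_all add: P_def)
  then show U: "P \<in> unitary_mats n" by (rule unitary_matsI[OF P])
  have comm: "mat_diag n d * P = P * mat_diag n (\<lambda>i. d (p i))"
    by (subst mat_diag_mult_left[OF P], subst mat_diag_mult_right[OF P])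
      (auto intro!: eq_matI simp: P_def)
  have "P * mat_diag n (\<lambda>i. d (p i)) * mat_adjoint P = mat_diag n d * (P * mat_adjoint P)"
    using P by (simp add: comm[symmetric] assoc_mult_mat[of _ n n _ n _ n])
  also have "\<dots> = mat_diag n d"
    by (simp add: unitary_matsD(3)[OF U] right_mult_one_mat[of _ n n])
  finally show "mat_diag n d = P * mat_diag n (\<lambda>i. d (p i)) * mat_adjoint P" by simp
qed

lemma exists_decreasing_permutation:
  fixes d :: "nat \<Rightarrow> 'a::linorder"
  obtains p where "p permutes {..<n}" "\<And>i j. i \<le> j \<Longrightarrow> j < n \<Longrightarrow> d (p j) \<le> d (p i)"
proof -
  let ?ys = "map d [0..<n]"
  let ?xs = "rev (sort ?ys)"
  have "mset ?xs = mset ?ys" by simp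
  then obtain p where p: "p permutes {..<length ?ys}" "permute_list p ?ys = ?xs"
    by (rule mset_eq_permutation)
  have pn: "p i < n" if "i < n" for i using permutes_in_image[OF p(1), of i] that by simp
  have nth: "?xs ! i = d (p i)" if "i < n" for i
    using that pn[OF that] by (simp add: permute_list_def flip: p(2))
  have "d (p j) \<le> d (p i)" if "i \<le> j" "j < n" for i j
    using sorted_rev_nth_mono[of ?xs i j] that nth[of i] nth[of j] by simp
  with p(1) that show thesis by simp
qed

lemma svd:
  fixes T :: "complex mat"
  assumes T: "T \<in> carrier_mat n n"
  obtains U V d where "U \<in> unitary_mats n" "V \<in> unitary_mats n"
    "T = U * mat_diag n (\<lambda>i. complex_of_real (d i)) * V"
    "\<And>i. i < n \<Longrightarrow> 0 \<le> d i" "\<And>i j. i \<le> j \<Longrightarrow> j < n \<Longrightarrow> d j \<le> d i"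
proof -
  obtain U V e where UV: "U \<in> unitary_mats n" "V \<in> unitary_mats n" "\<forall>i<n. 0 \<le> e i"
      and Te: "T = U * mat_diag n (\<lambda>i. complex_of_real (e i)) * V"
    using svd_unsorted[OF T] by blast
  obtain p where p: "p permutes {..<n}" "\<And>i j. i \<le> j \<Longrightarrow> j < n \<Longrightarrow> e (p j) \<le> e (p i)"
    using exists_decreasing_permutation[of n e] by blast
  obtain P where P: "P \<in> unitary_mats n" and
      eP: "mat_diag n (\<lambda>i. complex_of_real (e i))
        = P * mat_diag n (\<lambda>i. complex_of_real (e (p i))) * mat_adjoint P"
    using mat_diag_permute[OF p(1), of "\<lambda>i. complex_of_real (e i)"] .
  note c = UV(1,2)[THEN unitary_matsD(1)] unitary_matsD(1)[OF P]
  have "T = (U * P) * mat_diag n (\<lambda>i. complex_of_real (e (p i))) * (mat_adjoint P * V)"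
    unfolding Te eP using c by (simp add: assoc_mult_mat[of _ n n _ n _ n])
  moreover have "p i < n" if "i < n" for i using permutes_in_image[OF p(1), of i] that by simp
  ultimately show thesis
    using that[of "U * P" "mat_adjoint P * V" "\<lambda>i. e (p i)"] p(2) UV P
    by (simp add: unitary_mult unitary_adjoint)
qed

section \<open>Unitarily invariant norms\<close>

text \<open>
  By the singular value decomposition and homogeneity, an absolutely homogeneous unitarily invariant
  function is determined by its values on decreasing nonnegative diagonals with leading entry \<open>1\<close>.
  Since these two properties pass to linear combinations, the lemma also compares a norm with a
  convex combination of norms.
\<close>

lemma unitarily_invariant_eqI:
  fixes F G :: "complex mat \<Rightarrow> real"
  assumes n: "n > 0"
    and homF: "\<And>c T. T \<in> carrier_mat n n \<Longrightarrow> F (c \<cdot>\<^sub>m T) = cmod c * F T"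
    and uiF: "unitarily_invariant n F"
    and homG: "\<And>c T. T \<in> carrier_mat n n \<Longrightarrow> G (c \<cdot>\<^sub>m T) = cmod c * G T"
    and uiG: "unitarily_invariant n G"
    and eq: "\<And>s. s 0 = (1::real) \<Longrightarrow> \<forall>i<n. 0 \<le> s i \<Longrightarrow> \<forall>i. Suc i < n \<longrightarrow> s (Suc i) \<le> s i \<Longrightarrow>
      F (mat_diag n (\<lambda>i. complex_of_real (s i))) = G (mat_diag n (\<lambda>i. complex_of_real (s i)))"
  shows "norm_eq_on n F G"
  unfolding norm_eq_on_def
proof
  fix T :: "complex mat" assume "T \<in> carrier_mat n n"
  then obtain U V d where UV: "U \<in> unitary_mats n" "V \<in> unitary_mats n"
    and T: "T = U * mat_diag n (\<lambda>i. complex_of_real (d i)) * V"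
    and d: "\<And>i. i < n \<Longrightarrow> 0 \<le> d i" "\<And>i j. i \<le> j \<Longrightarrow> j < n \<Longrightarrow> d j \<le> d i"
    using svd by blast
  \<comment> \<open>If the largest singular value vanishes, all do, and any admissible diagonal \<open>s\<close> represents \<open>T\<close>
    with the factor \<open>0\<close>; the constant \<open>1\<close> is one.\<close>
  define s where "s = (\<lambda>i. if d 0 = 0 then 1 else d i / d 0)"
  have d0: "d i = d 0 * s i" if "i < n" for i
    using d(1)[OF that] d(2)[OF _ that, of 0] by (auto simp: s_def)
  let ?S = "mat_diag n (\<lambda>i. complex_of_real (s i))"
  have D: "mat_diag n (\<lambda>i. complex_of_real (d i)) = complex_of_real (d 0) \<cdot>\<^sub>m ?S"
    by (intro eq_matI) (auto simp: mat_diag_def, metis d0 of_real_mult)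
  have "F ?S = G ?S"
    using d n by (intro eq) (auto simp: s_def divide_right_mono)
  moreover have "F T = F (complex_of_real (d 0) \<cdot>\<^sub>m ?S)" "G T = G (complex_of_real (d 0) \<cdot>\<^sub>m ?S)"
    using uiF uiG UV unfolding T D[symmetric] unitarily_invariant_def by auto
  ultimately show "F T = G T" by (simp add: homF homG)
qed

lemma normalized_ui_normsD:
  assumes "A \<in> normalized_ui_norms n"
  shows "A (1\<^sub>m n) = 1" "unitarily_invariant n A"
    "\<And>T. T \<in> carrier_mat n n \<Longrightarrow> 0 \<le> A T"
    "\<And>T. T \<in> carrier_mat n n \<Longrightarrow> A T = 0 \<longleftrightarrow> T = 0\<^sub>m n n"
    "\<And>c T. T \<in> carrier_mat n n \<Longrightarrow> A (c \<cdot>\<^sub>m T) = cmod c * A T"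
    "\<And>S T. S \<in> carrier_mat n n \<Longrightarrow> T \<in> carrier_mat n n \<Longrightarrow> A (S + T) \<le> A S + A T"
    "\<And>U T V. T \<in> carrier_mat n n \<Longrightarrow> U \<in> unitary_mats n \<Longrightarrow> V \<in> unitary_mats n \<Longrightarrow>
      A (U * T * V) = A T"
  using assms by (auto simp: normalized_ui_norms_def is_mat_norm_def unitarily_invariant_def)

text \<open>
  With the unitary \<open>J = 1 \<oplus> (- 1)\<close>, the matrix \<open>X \<oplus> 0\<close> is the average of \<open>X \<oplus> Y\<close> and
  \<open>J (X \<oplus> Y) = X \<oplus> (- Y)\<close>, two matrices of equal norm.
\<close>

lemma norm_truncation_le:
  assumes A: "A \<in> normalized_ui_norms (m + r)"
    and X: "X \<in> carrier_mat m m" and Y: "Y \<in> carrier_mat r r"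
  shows "A (X \<oplus>\<^sub>m 0\<^sub>m r r) \<le> A (X \<oplus>\<^sub>m Y)"
proof -
  note A = normalized_ui_normsD[OF A]
  let ?J = "1\<^sub>m m \<oplus>\<^sub>m (- 1 \<cdot>\<^sub>m 1\<^sub>m r) :: complex mat"
  have "mat_adjoint (- 1 \<cdot>\<^sub>m 1\<^sub>m r) = (- 1 \<cdot>\<^sub>m 1\<^sub>m r :: complex mat)"
    by (rule eq_matI) auto
  moreover have "(- 1 \<cdot>\<^sub>m 1\<^sub>m r) * (- 1 \<cdot>\<^sub>m 1\<^sub>m r) = (1\<^sub>m r :: complex mat)"
    by (subst mult_smult_assoc_mat[of _ r r _ r]) (auto intro!: eq_matI)
  ultimately have "- 1 \<cdot>\<^sub>m 1\<^sub>m r \<in> unitary_mats r"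
    by (intro unitary_matsI) simp_all
  then have J: "?J \<in> unitary_mats (m + r)" by (rule unitary_direct_sum[OF unitary_one])
  have XY: "X \<oplus>\<^sub>m Y \<in> carrier_mat (m + r) (m + r)" and X0: "X \<oplus>\<^sub>m 0\<^sub>m r r \<in> carrier_mat (m + r) (m + r)"
    and JXY: "?J * (X \<oplus>\<^sub>m Y) \<in> carrier_mat (m + r) (m + r)"
    using X Y unitary_matsD(1)[OF J] by simp_all
  have "?J * (X \<oplus>\<^sub>m Y) = X \<oplus>\<^sub>m (- 1 \<cdot>\<^sub>m Y)"
    using X Y by (simp add: direct_sum_mult[of _ m _ r] mult_smult_assoc_mat[of _ r r _ r])
  then have "(X \<oplus>\<^sub>m Y) + ?J * (X \<oplus>\<^sub>m Y) = 2 \<cdot>\<^sub>m (X \<oplus>\<^sub>m 0\<^sub>m r r)"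
    using X Y by (intro eq_matI) (auto simp: mat_direct_sum_def)
  then have "2 * A (X \<oplus>\<^sub>m 0\<^sub>m r r) = A ((X \<oplus>\<^sub>m Y) + ?J * (X \<oplus>\<^sub>m Y))"
    using A(5)[OF X0, of 2] by simp
  also have "\<dots> \<le> A (X \<oplus>\<^sub>m Y) + A (?J * (X \<oplus>\<^sub>m Y))" by (rule A(6)[OF XY JXY])
  also have "A (?J * (X \<oplus>\<^sub>m Y)) = A (X \<oplus>\<^sub>m Y)"
    using A(7)[OF XY J unitary_one] by (simp only: right_mult_one_mat[OF JXY])
  finally show ?thesis by simp
qed

text \<open>
  Unitary invariance survives because \<open>U T V \<oplus> 0 = (U \<oplus> 1) (T \<oplus> 0) (V \<oplus> 1)\<close>. Normalization has to be
  assumed: a unitarily invariant norm may be smaller on the projection \<open>1 \<oplus> 0\<close> than on the identity,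
  as the normalized trace norm is.
\<close>

lemma corner_norm:
  assumes A: "A \<in> normalized_ui_norms (m + r)" and one: "A (1\<^sub>m m \<oplus>\<^sub>m 0\<^sub>m r r) = 1"
  shows "(\<lambda>T. A (T \<oplus>\<^sub>m 0\<^sub>m r r)) \<in> normalized_ui_norms m"
proof -
  note A = normalized_ui_normsD[OF A]
  have c: "T \<oplus>\<^sub>m 0\<^sub>m r r \<in> carrier_mat (m + r) (m + r)" if "T \<in> carrier_mat m m" for T :: "complex mat"
    using that by simp
  have zero: "T \<oplus>\<^sub>m 0\<^sub>m r r = 0\<^sub>m (m + r) (m + r) \<longleftrightarrow> T = 0\<^sub>m m m"
    if T: "T \<in> carrier_mat m m" for T :: "complex mat"
  proof
    assume z: "T \<oplus>\<^sub>m 0\<^sub>m r r = 0\<^sub>m (m + r) (m + r)"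
    show "T = 0\<^sub>m m m"
    proof (rule eq_matI)
      fix i j assume ij: "i < dim_row (0\<^sub>m m m :: complex mat)" "j < dim_col (0\<^sub>m m m :: complex mat)"
      have "(T \<oplus>\<^sub>m 0\<^sub>m r r) $$ (i,j) = 0" using z ij by simp
      then show "T $$ (i,j) = 0\<^sub>m m m $$ (i,j)" using ij T by (simp add: mat_direct_sum_def)
    qed (use T in auto)
  qed (simp add: mat_direct_sum_def)
  have smult: "(k \<cdot>\<^sub>m T) \<oplus>\<^sub>m 0\<^sub>m r r = k \<cdot>\<^sub>m (T \<oplus>\<^sub>m 0\<^sub>m r r)"
    if T: "T \<in> carrier_mat m m" for k and T :: "complex mat"
    using direct_sum_smult[OF T zero_carrier_mat[of r r]] by simp
  have add: "(S + T) \<oplus>\<^sub>m 0\<^sub>m r r = (S \<oplus>\<^sub>m 0\<^sub>m r r) + (T \<oplus>\<^sub>m 0\<^sub>m r r)"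
    if "S \<in> carrier_mat m m" "T \<in> carrier_mat m m" for S T :: "complex mat"
    using that by (simp add: direct_sum_add[of S m _ r])
  have inv: "A ((U * T * V) \<oplus>\<^sub>m 0\<^sub>m r r) = A (T \<oplus>\<^sub>m 0\<^sub>m r r)"
    if T: "T \<in> carrier_mat m m" and U: "U \<in> unitary_mats m" and V: "V \<in> unitary_mats m" for U T V
  proof -
    have "(U * T * V) \<oplus>\<^sub>m 0\<^sub>m r r = (U \<oplus>\<^sub>m 1\<^sub>m r) * (T \<oplus>\<^sub>m 0\<^sub>m r r) * (V \<oplus>\<^sub>m 1\<^sub>m r)"
      using T unitary_matsD(1)[OF U] unitary_matsD(1)[OF V] by (simp add: direct_sum_mult[of _ m _ r])
    then show ?thesis
      using A(7)[OF c[OF T] unitary_direct_sum[OF U unitary_one] unitary_direct_sum[OF V unitary_one]]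
      by simp
  qed
  show ?thesis
    unfolding normalized_ui_norms_def is_mat_norm_def unitarily_invariant_def
    using A(3)[OF c] A(4)[OF c] A(5)[OF c] A(6)[OF c c] one by (auto simp: zero smult add inv)
qed

theorem proposition10p5:
  fixes m n :: nat and N N1 :: "complex mat \<Rightarrow> real"
  assumes "1 \<le> m" and "m \<le> n"
    and "N \<in> normalized_ui_norms m"
    and "is_induced_norm m N n N1"
    and "extreme_normalized_ui_norm m N"
  shows "extreme_normalized_ui_norm n N1"
proof -
  define r where "r = n - m"
  have n: "n = m + r" using assms(2) by (simp add: r_def)
  let ?diag = "\<lambda>k s. mat_diag k (\<lambda>i. complex_of_real (s i))"
  \<comment> \<open>\<open>sv k s\<close>: the first \<open>k\<close> terms of \<open>s\<close> are the singular values of a matrix of operator norm \<open>1\<close>;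
    \<open>tr s\<close> truncates \<open>s\<close> after \<open>m\<close> terms.\<close>
  define sv where "sv = (\<lambda>k s. s 0 = (1::real) \<and> (\<forall>i<k. 0 \<le> s i) \<and> (\<forall>i. Suc i < k \<longrightarrow> s (Suc i) \<le> s i))"
  define tr where "tr = (\<lambda>s i. if i < m then s i else (0::real))"
  have N1: "N1 \<in> normalized_ui_norms n" and ind: "\<And>s. sv n s \<Longrightarrow> N1 (?diag n s) = N (?diag m s)"
    using assms(4) by (auto simp: is_induced_norm_def sv_def)
  have sv_tr: "sv n (tr s)" if "sv m s" for s using that assms(1) by (auto simp: sv_def tr_def)
  have sv_n: "sv m s" if "sv n s" for s using that assms(2) by (auto simp: sv_def)
  have diag_tr: "?diag m (tr s) = ?diag m s" for s
    by (intro eq_matI) (auto simp: mat_diag_def tr_def)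
  have pad: "?diag n (tr s) = ?diag m s \<oplus>\<^sub>m 0\<^sub>m r r" for s
    by (intro eq_matI) (auto simp: n mat_diag_def tr_def mat_direct_sum_def)
  have extremal: "norm_eq_on m A B"
    if "A \<in> normalized_ui_norms m" "B \<in> normalized_ui_norms m" "0 < t" "t < 1"
      "norm_eq_on m N (\<lambda>T. (1 - t) * A T + t * B T)" for A B and t :: real
    using assms(5) that unfolding extreme_normalized_ui_norm_def by blast
  have "norm_eq_on n A B"
    if A: "A \<in> normalized_ui_norms n" and B: "B \<in> normalized_ui_norms n" and t: "0 < t" "t < 1"
      and comb: "norm_eq_on n N1 (\<lambda>T. (1 - t) * A T + t * B T)" for A B and t :: real
  proof -
    \<comment> \<open>Truncation decreases both \<open>A\<close> and \<open>B\<close> weakly and keeps \<open>N1\<close>, so it keeps \<open>A\<close> and \<open>B\<close>.\<close>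
    have trunc: "A (?diag n s) = A (?diag m s \<oplus>\<^sub>m 0\<^sub>m r r) \<and> B (?diag n s) = B (?diag m s \<oplus>\<^sub>m 0\<^sub>m r r)"
      if s: "sv n s" for s
    proof -
      let ?D = "?diag n s" and ?Dm = "?diag n (tr s)"
      have D: "?D = ?diag m s \<oplus>\<^sub>m mat_diag r (\<lambda>i. complex_of_real (s (m + i)))"
        unfolding n by (rule mat_diag_direct_sum)
      have le: "A ?Dm \<le> A ?D" "B ?Dm \<le> B ?D"
        unfolding pad D using A B by (auto intro!: norm_truncation_le simp: n)
      have "N1 ?Dm = N1 ?D"
        using ind[OF s] ind[OF sv_tr[OF sv_n[OF s]]] by (simp add: diag_tr)
      moreover have "N1 X = (1 - t) * A X + t * B X" if "X \<in> carrier_mat n n" for X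
        using comb that by (simp add: norm_eq_on_def)
      from this[of ?D] this[of ?Dm]
      have "N1 ?D = (1 - t) * A ?D + t * B ?D" "N1 ?Dm = (1 - t) * A ?Dm + t * B ?Dm"
        by simp_all
      ultimately have "(1 - t) * (A ?D - A ?Dm) + t * (B ?D - B ?Dm) = 0"
        by (simp add: right_diff_distrib)
      moreover have "(1 - t) * (A ?D - A ?Dm) \<ge> 0" "t * (B ?D - B ?Dm) \<ge> 0" using le t by simp_all
      ultimately have "(1 - t) * (A ?D - A ?Dm) = 0" "t * (B ?D - B ?Dm) = 0" by linarith+
      then show ?thesis using t by (simp add: pad)
    qed
    let ?A = "\<lambda>T. A (T \<oplus>\<^sub>m 0\<^sub>m r r)" and ?B = "\<lambda>T. B (T \<oplus>\<^sub>m 0\<^sub>m r r)"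
    \<comment> \<open>The constant sequence \<open>1\<close> is the identity matrix, so the corner norms are normalized.\<close>
    have "sv n (\<lambda>_. 1)" by (simp add: sv_def)
    then have "?A (1\<^sub>m m) = 1" "?B (1\<^sub>m m) = 1"
      using trunc[of "\<lambda>_. 1"] normalized_ui_normsD(1)[OF A] normalized_ui_normsD(1)[OF B] by auto
    then have A': "?A \<in> normalized_ui_norms m" and B': "?B \<in> normalized_ui_norms m"
      using A B by (auto intro: corner_norm simp: n)
    note A'D = normalized_ui_normsD[OF A'] and B'D = normalized_ui_normsD[OF B']
    have "norm_eq_on m N (\<lambda>T. (1 - t) * ?A T + t * ?B T)"
    proof (rule unitarily_invariant_eqI)
      show "m > 0" using assms(1) by simp
      show "unitarily_invariant m N" by (rule normalized_ui_normsD(2)[OF assms(3)])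
      show "unitarily_invariant m (\<lambda>T. (1 - t) * ?A T + t * ?B T)"
        using A'D(7) B'D(7) by (simp add: unitarily_invariant_def)
      fix s :: "nat \<Rightarrow> real"
      assume "s 0 = 1" "\<forall>i<m. 0 \<le> s i" "\<forall>i. Suc i < m \<longrightarrow> s (Suc i) \<le> s i"
      then have s: "sv m s" by (simp add: sv_def)
      have "N (?diag m s) = N1 (?diag n (tr s))" using ind[OF sv_tr[OF s]] by (simp add: diag_tr)
      also have "\<dots> = (1 - t) * A (?diag n (tr s)) + t * B (?diag n (tr s))"
        using comb by (simp add: norm_eq_on_def)
      finally show "N (?diag m s) = (1 - t) * ?A (?diag m s) + t * ?B (?diag m s)" by (simp add: pad)
    qed (simp_all add: normalized_ui_normsD(5)[OF assms(3)] A'D(5) B'D(5) algebra_simps)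
    then have "norm_eq_on m ?A ?B"
      by (rule extremal[OF A' B' t])
    then have corner: "?A (?diag m s) = ?B (?diag m s)" for s by (simp add: norm_eq_on_def)
    show ?thesis
    proof (rule unitarily_invariant_eqI)
      show "n > 0" using assms by simp
      fix s :: "nat \<Rightarrow> real"
      assume "s 0 = 1" "\<forall>i<n. 0 \<le> s i" "\<forall>i. Suc i < n \<longrightarrow> s (Suc i) \<le> s i"
      then have "sv n s" by (simp add: sv_def)
      then show "A (?diag n s) = B (?diag n s)" using trunc corner by metis
    qed (simp_all add: normalized_ui_normsD[OF A] normalized_ui_normsD[OF B])
  qed
  with N1 show ?thesis unfolding extreme_normalized_ui_norm_def by blast
qed

end
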